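(* For every positive integer $n$, the following identities (of polynomials in $x$) hold: (i) $$T_n(x)+n\sum_{k=1}^{n}(-2T_1(x))^k\left(\sum_{i=0}^{\left[\frac{n-k}{2}\right]}\frac{1}{n-i}\binom{n-i}{k}\binom{k+i-1}{k-1}T_{n-k-2i}(x)\right)=n\sum_{k=1}^{n}\frac{(-2)^k}{k!}\,\frac{1+(-1)^{n-k}}{4}\left(\frac{n+k}{2}-1\right)^{\underline{k-1}}\binom{\frac{n+k}{2}-1}{k-1}T_1(x)^k+\cos\frac{\pi n}{2};$$ (ii) $$\sum_{k=0}^{n}\left(\sum_{i=0}^{\left[\frac{n-k}{2}\right]}(-2)^{n-(k+2i)}\frac{1}{n-i}\binom{n-i}{k+i}\binom{n-k-i-1}{i}T_1(x)^{n-(k+2i)}\right)T_k(x)=\sum_{k=0}^{n}\left(1+(-1)^{n-k}\right)\frac{k(-2)^k}{(n+k)^2}\binom{\frac{n+k}{2}}{k}^2T_1(x)^k+\frac1n\cos\frac{\pi n}{2};$$ (iii) $$P_n^{\left(-\frac12,-\frac12\right)}(x)+\sum_{k=1}^{n}\frac{(-x)^k(n+k-1)!}{k!\,2^k\,(n-1)!}P_{n-k}^{\left(k-\frac12,k-\frac12\right)}(x)=\left(\frac12\right)_n\frac{1}{n!}\cos\frac{\pi n}{2}.$$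
   Context: The Chebyshev polynomials of the first kind $T_n(x)$ are defined by $\frac{1-xt}{1-2xt+t^2}=\sum_{n\ge 0}T_n(x)t^n$. $P_n^{(\alpha,\beta)}(x)$ denotes the Jacobi polynomial of degree $n$, with the standard normalization $P_n^{(\alpha,\beta)}(1)=\binom{n+\alpha}{n}$. Notation: $[a]$ in summation limits is the integer part; $a^{\underline m}=a(a-1)\cdots(a-m+1)$ is the falling factorial ($a^{\underline 0}=1$); $\binom{a}{m}=a^{\underline m}/m!$ for integers $m\ge 0$ and arbitrary $a$ (in particular $\binom{-1}{0}=1$); $(a)_m=a(a+1)\cdots(a+m-1)$ is the rising factorial. *)

theory Defs
  imports Complex_Main "HOL-Computational_Algebra.Computational_Algebra"
begin

(* The generating function is a power series in t (here fps_X) over the ring of polynomials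
   in x (here [:0, 1:]). That ring is not a division ring, so the quotient is taken with
   fps_right_inverse; the denominator has constant term 1, which is its own inverse. *)
definition chebyshev_T :: "nat \<Rightarrow> real poly" where
  "chebyshev_T n = fps_nth
     ((1 - fps_const [:0, 1:] * fps_X) *
      fps_right_inverse (1 - 2 * fps_const [:0, 1:] * fps_X + fps_X ^ 2) 1) n"

lemma chebyshev_T_generating_function:
  "Abs_fps chebyshev_T * (1 - 2 * fps_const [:0, 1:] * fps_X + fps_X ^ 2) =
     1 - fps_const [:0, 1:] * fps_X"
proof -
  define d :: "real poly fps" where "d = 1 - 2 * fps_const [:0, 1:] * fps_X + fps_X ^ 2"
  define r where "r = fps_right_inverse d 1"
  define c :: "real poly fps" where "c = 1 - fps_const [:0, 1:] * fps_X"
  have "fps_nth d 0 * 1 = 1"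
    by (simp add: d_def fps_mult_nth_0)
  then have "d * r = 1"
    unfolding r_def by (rule fps_right_inverse)
  moreover have "Abs_fps chebyshev_T = c * r"
    by (simp add: fps_eq_iff chebyshev_T_def c_def r_def d_def)
  ultimately have "Abs_fps chebyshev_T * d = c"
    by (simp add: mult.assoc mult.commute[of r d])
  then show ?thesis
    by (simp only: c_def d_def)
qed

definition falling_factorial :: "real \<Rightarrow> nat \<Rightarrow> real" where
  "falling_factorial a m = (\<Prod>i<m. a - real i)"

(* For alpha not a negative integer this is
     (alpha+1)_n / n! * 2F1 (-n, n + alpha + beta + 1; alpha + 1; (1 - x) / 2),
   rewritten so that no denominator depends on alpha; [:-1/2, 1/2:] is (x - 1) / 2. *)
definition jacobi_P :: "nat \<Rightarrow> real \<Rightarrow> real \<Rightarrow> real poly" where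
  "jacobi_P n \<alpha> \<beta> =
     (\<Sum>m=0..n. smult (((real n + \<alpha>) gchoose (n - m)) *
                       ((real n + \<alpha> + \<beta> + real m) gchoose m))
                 ([:-1/2, 1/2:] ^ m))"

lemma poly_jacobi_P_1: "poly (jacobi_P n \<alpha> \<beta>) 1 = (real n + \<alpha>) gchoose n"
proof -
  have "poly (jacobi_P n \<alpha> \<beta>) 1 =
      (\<Sum>m=0..n. if m = 0 then (real n + \<alpha>) gchoose n else 0)"
    unfolding jacobi_P_def poly_sum by (rule sum.cong) (auto simp: poly_power)
  then show ?thesis
    by simp
qed

end

theory Submission
  imports Defs
begin

text \<open>All three identities are the Taylor expansion
  \<open>\<Sum>k. (-x)^k / k! * p^(k)(x) = p(0)\<close> of a polynomial \<open>p\<close>.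

  For (i), \<open>p = T_n\<close>. With \<open>F = 1 / (1 - 2xt + t^2)\<close>, differentiating generating functions shows that
  \<open>T_n^(k)\<close> is \<open>n 2^(k-1) (k-1)!\<close> times the coefficient of \<open>t^(n-k)\<close> in \<open>F^k\<close>. At
  \<open>x = cos \<theta>\<close> the series \<open>F\<close> is a product of geometric series in \<open>t e^(\<plusminus>i\<theta>)\<close>, which expresses
  that coefficient by the \<open>T_(n-k-2i)\<close>. Folding the symmetric sum counts the constant term
  \<open>T_0\<close> twice when \<open>n - k\<close> is even; these corrections form the sum on the right of (i).
  Identity (ii) is (i) divided by \<open>n\<close> and resummed over \<open>n - k - 2i\<close>.

  For (iii), \<open>p = P_n^(-1/2,-1/2)\<close>, whose derivatives are again Jacobi polynomials. Its value at \<open>0\<close>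
  is that of \<open>(1/2)_n / n! * T_n\<close>, by comparison with the Taylor expansion of \<open>T_n\<close> at \<open>1\<close>.\<close>

subsection \<open>Taylor expansion of polynomials\<close>

text \<open>Read the Taylor sum as a polynomial \<open>L n\<close> in the base point. Its derivative
  telescopes to the single term containing the derivative of \<open>p\<close> of order
  \<open>n + 1\<close>, which vanishes. So \<open>L n\<close> is constant, and its value at base
  point \<open>c\<close> is \<open>poly p c\<close>.\<close>

lemma poly_taylor:
  fixes p :: "real poly"
  assumes "degree p \<le> n"
  shows "(\<Sum>k\<le>n. (c - x) ^ k / fact k * poly ((pderiv ^^ k) p) x) = poly p c"
proof -
  define L :: "nat \<Rightarrow> real poly" where
    "L N = (\<Sum>k\<le>N. smult (1 / fact k) ([:c, -1:] ^ k * (pderiv ^^ k) p))" for N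
  have L': "pderiv (L N) = smult (1 / fact N) ([:c, -1:] ^ N * (pderiv ^^ Suc N) p)" for N
  proof (induction N)
    case 0
    show ?case by (simp add: L_def)
  next
    case (Suc N)
    have s: "L (Suc N) = L N + smult (1 / fact (Suc N)) ([:c, -1:] ^ Suc N * (pderiv ^^ Suc N) p)"
      by (simp add: L_def)
    have d: "pderiv ([:c, -1:] ^ Suc N) = smult (- real (Suc N)) ([:c, -1:] ^ N)"
      by (simp only: pderiv_power_Suc) (simp add: pderiv_pCons)
    have "pderiv (L (Suc N)) = smult (1 / fact (Suc N)) ([:c, -1:] ^ Suc N * (pderiv ^^ Suc (Suc N)) p)
       + (smult (1 / fact N) ([:c, -1:] ^ N * (pderiv ^^ Suc N) p) +
          smult (1 / fact (Suc N) * - real (Suc N)) ([:c, -1:] ^ N * (pderiv ^^ Suc N) p))"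
      unfolding s pderiv_add Suc.IH pderiv_smult pderiv_mult d
      by (simp add: smult_add_right smult_diff_right mult_ac del: power_Suc fact_Suc of_nat_Suc)
    also have "1 / fact (Suc N) * - real (Suc N) = - (1 / fact N)"
      by (simp add: field_simps del: of_nat_Suc)
    finally show ?case
      by (simp del: power_Suc fact_Suc)
  qed
  have "(pderiv ^^ Suc n) p = 0"
    using assms degree_higher_pderiv[of n p] by (simp add: pderiv_eq_0_iff)
  then have "pderiv (L n) = 0"
    unfolding L' by simp
  then obtain h where h: "L n = [:h:]"
    using pderiv_iszero by blast
  have eval: "poly (L n) y = (\<Sum>k\<le>n. (c - y) ^ k / fact k * poly ((pderiv ^^ k) p) y)" for y
    by (simp add: L_def poly_sum poly_power)
  \<comment> \<open>At base point \<open>c\<close> only the summand with \<open>0 ^ 0 = 1\<close>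
    survives.\<close>
  have "poly (L n) c = (\<Sum>k\<le>n. if k = 0 then poly p c else 0)"
    unfolding eval by (intro sum.cong) auto
  also have "\<dots> = poly p c"
    by simp
  finally show ?thesis
    using eval[of x] h by simp
qed

subsection \<open>Chebyshev polynomials and their generating function\<close>

definition cheb_denom :: "real poly fps" where
  "cheb_denom = 1 - 2 * fps_const [:0, 1:] * fps_X + fps_X ^ 2"

text \<open>The series F, which generates the Chebyshev polynomials of the second kind. The argument
  \<open>1\<close> is the inverse of the constant coefficient of \<open>cheb_denom\<close>.\<close>

definition cheb_kernel :: "real poly fps" where
  "cheb_kernel = fps_right_inverse cheb_denom 1"

lemma cheb_denom_kernel: "cheb_denom * cheb_kernel = 1"
  unfolding cheb_kernel_def
  by (rule fps_right_inverse) (simp add: cheb_denom_def fps_mult_nth_0)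

lemma chebyshev_T_gf: "Abs_fps chebyshev_T = (1 - fps_const [:0, 1:] * fps_X) * cheb_kernel"
  by (simp add: fps_eq_iff chebyshev_T_def cheb_kernel_def cheb_denom_def)

lemma cheb_denom_altdef: "cheb_denom = 1 - fps_const [:0, 2:] * fps_X + fps_X ^ 2"
  by (simp add: cheb_denom_def fps_numeral_fps_const numeral_poly)

lemma cheb_denom_nth:
  "fps_nth cheb_denom n = (if n = 0 then 1 else if n = 1 then [:0, -2:] else if n = 2 then 1 else 0)"
  by (auto simp: cheb_denom_altdef fps_X_nth fps_X_power_nth)

lemma chebyshev_T_0: "chebyshev_T 0 = 1"
  by (simp add: chebyshev_T_def)

lemma chebyshev_T_denom:
  "Abs_fps chebyshev_T * cheb_denom = 1 - fps_const [:0, 1:] * fps_X"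
  unfolding cheb_denom_def by (rule chebyshev_T_generating_function)

lemma chebyshev_T_1: "chebyshev_T 1 = [:0, 1:]"
proof -
  have "fps_nth (Abs_fps chebyshev_T * cheb_denom) 1 = [:0, -1:]"
    unfolding chebyshev_T_denom by simp
  then have "chebyshev_T 1 + [:0, -2:] = [:0, -1:]"
    by (simp add: fps_mult_nth_1 cheb_denom_nth chebyshev_T_0)
  then have "chebyshev_T 1 = [:0, -1:] - [:0, -2:]"
    by (simp only: eq_diff_eq)
  then show ?thesis by simp
qed

text \<open>Compare coefficients of t^(n+2) after clearing the denominator; 1 - xt contributes
  none.\<close>

lemma chebyshev_T_Suc_Suc:
  "chebyshev_T (Suc (Suc n)) = [:0, 2:] * chebyshev_T (Suc n) - chebyshev_T n"
proof -
  define T where "T = Abs_fps chebyshev_T"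
  have "T * cheb_denom = T - fps_const [:0, 2:] * (fps_X * T) + fps_X * (fps_X * T)"
    by (simp add: cheb_denom_altdef algebra_simps power2_eq_square)
  then have "fps_nth (T - fps_const [:0, 2:] * (fps_X * T) + fps_X * (fps_X * T)) (Suc (Suc n)) =
      fps_nth (1 - fps_const [:0, 1:] * fps_X) (Suc (Suc n))"
    by (simp only: T_def chebyshev_T_denom)
  then have "chebyshev_T (Suc (Suc n)) - [:0, 2:] * chebyshev_T (Suc n) + chebyshev_T n = 0"
    by (simp add: T_def fps_X_nth del: mult_pCons_left)
  then show ?thesis
    by (simp add: algebra_simps eq_neg_iff_add_eq_0 del: mult_pCons_left)
qed

lemma poly_chebyshev_T_cos: "poly (chebyshev_T n) (cos \<theta>) = cos (real n * \<theta>)"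
proof (induction n rule: less_induct)
  case (less n)
  consider "n = 0" | "n = 1" | m where "n = Suc (Suc m)"
    by (metis One_nat_def not0_implies_Suc)
  then show ?case
  proof cases
    case (3 m)
    \<comment> \<open>Sum-to-product with half-sum m + 1 and half-difference 1 of the multiples of
      \<theta>: the cosines obey the same recurrence.\<close>
    have "cos (real n * \<theta>) + cos (real m * \<theta>) = 2 * cos \<theta> * cos (real (Suc m) * \<theta>)"
      using cos_plus_cos[of "real n * \<theta>" "real m * \<theta>"] 3
      by (simp add: algebra_simps add_divide_distrib)
    with 3 less[of m] less[of "Suc m"] show ?thesis
      by (simp add: chebyshev_T_Suc_Suc)
  qed (simp_all add: chebyshev_T_0 chebyshev_T_1[simplified])
qed

lemma poly_chebyshev_T_at_0: "poly (chebyshev_T n) 0 = cos (pi * real n / 2)"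
  using poly_chebyshev_T_cos[of n "pi / 2"] by (simp add: mult.commute)

lemma degree_chebyshev_T_le: "degree (chebyshev_T n) \<le> n"
proof (induction n rule: less_induct)
  case (less n)
  consider "n = 0" | "n = 1" | m where "n = Suc (Suc m)"
    by (metis One_nat_def not0_implies_Suc)
  then show ?case
  proof cases
    case (3 m)
    have "degree ([:0, 2:] * chebyshev_T (Suc m)) \<le> Suc (Suc m)"
      using degree_mult_le[of "[:0, 2:]" "chebyshev_T (Suc m)"] less[of "Suc m"] 3 by simp
    with 3 less[of m] show ?thesis
      unfolding 3 chebyshev_T_Suc_Suc by (intro degree_diff_le) auto
  qed (simp_all add: chebyshev_T_0 chebyshev_T_1[simplified])
qed

subsection \<open>Derivatives of Chebyshev polynomials\<close>

text \<open>The partial derivative in x; \<open>fps_deriv\<close> is the one in t.\<close>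

definition fps_pderiv :: "real poly fps \<Rightarrow> real poly fps" where
  "fps_pderiv f = Abs_fps (\<lambda>n. pderiv (fps_nth f n))"

lemma pderiv_sum: "pderiv (sum f A) = (\<Sum>x\<in>A. pderiv (f x))"
  for f :: "'a \<Rightarrow> real poly"
  using higher_pderiv_sum[of 1 f A] by simp

lemma fps_pderiv_mult: "fps_pderiv (f * g) = f * fps_pderiv g + g * fps_pderiv f"
proof (rule fps_ext)
  fix n
  have "(\<Sum>i=0..n. fps_nth g (n - i) * pderiv (fps_nth f i)) = fps_nth (g * fps_pderiv f) n"
    unfolding mult.commute[of g "fps_pderiv f"]
    by (simp add: fps_mult_nth fps_pderiv_def mult.commute[where 'a = "real poly"])
  then show "fps_nth (fps_pderiv (f * g)) n = fps_nth (f * fps_pderiv g + g * fps_pderiv f) n"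
    by (simp add: fps_pderiv_def fps_mult_nth pderiv_sum pderiv_mult sum.distrib)
qed

lemma fps_pderiv_1: "fps_pderiv 1 = 0"
  by (simp add: fps_pderiv_def fps_eq_iff)

lemma fps_pderiv_cheb_denom: "fps_pderiv cheb_denom = - (2 * fps_X)"
  by (auto simp: fps_pderiv_def fps_eq_iff cheb_denom_nth fps_numeral_fps_const pderiv_pCons
      numeral_poly)

text \<open>The denominator is a unit, so identities about \<open>cheb_kernel\<close> may be proved
  after multiplying by it.\<close>

lemma eq_if_denom_mult_eq: "cheb_denom * f = cheb_denom * g \<Longrightarrow> f = g"
  by (metis cheb_denom_kernel mult.commute mult.left_commute mult_1)

text \<open>Differentiate \<open>cheb_denom * cheb_kernel = 1\<close> in x; the denominator has
  derivative -2t.\<close>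

lemma fps_pderiv_kernel: "fps_pderiv cheb_kernel = 2 * fps_X * cheb_kernel ^ 2"
proof (rule eq_if_denom_mult_eq)
  have "cheb_denom * fps_pderiv cheb_kernel - cheb_kernel * (2 * fps_X) = 0"
    using arg_cong[OF cheb_denom_kernel, of fps_pderiv]
    by (simp add: fps_pderiv_mult fps_pderiv_1 fps_pderiv_cheb_denom)
  \<comment> \<open>The explicit factor \<open>1\<close> is there to be rewritten backwards into
    \<open>cheb_denom * cheb_kernel\<close>.\<close>
  then have "cheb_denom * fps_pderiv cheb_kernel = 2 * fps_X * (1 * cheb_kernel)"
    by (simp add: algebra_simps)
  then show "cheb_denom * fps_pderiv cheb_kernel = cheb_denom * (2 * fps_X * cheb_kernel ^ 2)"
    unfolding cheb_denom_kernel[symmetric] by (simp add: algebra_simps power2_eq_square)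
qed

lemma fps_pderiv_kernel_power:
  "fps_pderiv (cheb_kernel ^ k) = of_nat (2 * k) * fps_X * cheb_kernel ^ Suc k"
  by (induction k)
    (simp_all add: fps_pderiv_1 fps_pderiv_mult fps_pderiv_kernel algebra_simps power2_eq_square)

lemma fps_deriv_kernel:
  "fps_deriv cheb_kernel = 2 * (fps_const [:0, 1:] - fps_X) * cheb_kernel ^ 2"
proof (rule eq_if_denom_mult_eq)
  have "fps_deriv cheb_denom = 2 * (fps_X - fps_const [:0, 1:])"
    by (simp add: cheb_denom_def power2_eq_square algebra_simps)
  then have "cheb_denom * fps_deriv cheb_kernel + 2 * (fps_X - fps_const [:0, 1:]) * cheb_kernel = 0"
    using arg_cong[OF cheb_denom_kernel, of fps_deriv] by simp
  then have "cheb_denom * fps_deriv cheb_kernel =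
      2 * (fps_const [:0, 1:] - fps_X) * (1 * cheb_kernel)"
    by (simp add: algebra_simps)
  then show "cheb_denom * fps_deriv cheb_kernel =
      cheb_denom * (2 * (fps_const [:0, 1:] - fps_X) * cheb_kernel ^ 2)"
    unfolding cheb_denom_kernel[symmetric] by (simp add: algebra_simps power2_eq_square)
qed

text \<open>The x-derivative of the generating function of the T_n turns out to be t d/dt (t F),
  whose coefficients are read off directly.\<close>

lemma pderiv_chebyshev_T: "pderiv (chebyshev_T (Suc n)) = of_nat (Suc n) * fps_nth cheb_kernel n"
proof -
  define x :: "real poly fps" where "x = fps_const [:0, 1:]"
  have denom: "cheb_denom = 1 - 2 * x * fps_X + fps_X ^ 2"
    by (simp add: cheb_denom_def x_def)
  have px: "fps_pderiv (1 - x * fps_X) = - fps_X"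
    by (auto simp: fps_eq_iff fps_pderiv_def x_def pderiv_pCons pderiv_minus one_pCons fps_X_nth)
  \<comment> \<open>The factor \<open>cheb_denom * cheb_kernel\<close>, equal to 1, is inserted so
    that both terms contain \<open>cheb_kernel ^ 2\<close>.\<close>
  have "fps_pderiv (Abs_fps chebyshev_T) =
      (1 - x * fps_X) * (2 * fps_X * cheb_kernel ^ 2) - cheb_kernel * fps_X * (cheb_denom * cheb_kernel)"
    unfolding chebyshev_T_gf x_def[symmetric] fps_pderiv_mult fps_pderiv_kernel px cheb_denom_kernel
    by (simp add: algebra_simps)
  also have "\<dots> = fps_X * (cheb_kernel * (cheb_denom * cheb_kernel)
                 + fps_X * (2 * (x - fps_X) * cheb_kernel ^ 2))"
    unfolding denom by (simp add: algebra_simps power2_eq_square)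
  also have "\<dots> = fps_X * fps_deriv (fps_X * cheb_kernel)"
    by (simp add: cheb_denom_kernel fps_deriv_kernel x_def)
  finally have "fps_nth (fps_pderiv (Abs_fps chebyshev_T)) (Suc n) =
      fps_nth (fps_X * fps_deriv (fps_X * cheb_kernel)) (Suc n)"
    by simp
  then show ?thesis
    by (simp add: fps_pderiv_def algebra_simps)
qed

lemma pderiv_kernel_power_nth:
  "pderiv (fps_nth (cheb_kernel ^ k) (Suc m)) = of_nat (2 * k) * fps_nth (cheb_kernel ^ Suc k) m"
proof -
  have "fps_nth (fps_pderiv (cheb_kernel ^ k)) (Suc m) =
      fps_nth (fps_const (of_nat (2 * k)) * (fps_X * cheb_kernel ^ Suc k)) (Suc m)"
    unfolding fps_pderiv_kernel_power by (simp only: fps_of_nat mult.assoc)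
  then show ?thesis
    by (simp add: fps_pderiv_def del: power_Suc)
qed

text \<open>Each further x-derivative raises the power of F by one, lowers the coefficient index by
  one and contributes a factor 2k. The derivative of order 0 does not fit this pattern, hence the
  shift by \<open>Suc\<close>.\<close>

lemma higher_pderiv_chebyshev_T:
  "k \<le> m \<Longrightarrow> (pderiv ^^ Suc k) (chebyshev_T (Suc m)) =
     smult (real (Suc m) * 2 ^ k * fact k) (fps_nth (cheb_kernel ^ Suc k) (m - k))"
proof (induction k)
  case 0
  then show ?case
    by (simp add: pderiv_chebyshev_T of_nat_poly)
next
  case (Suc k)
  then have "m - k = Suc (m - Suc k)"
    by simp
  with Suc show ?case
    by (simp add: pderiv_smult pderiv_kernel_power_nth of_nat_poly mult_ac
        del: power_Suc of_nat_Suc) (simp add: algebra_simps)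
qed


subsection \<open>Expansion of the derivatives in Chebyshev polynomials\<close>

text \<open>Fixes x and moves to complex coefficients, where the denominator splits into linear
  factors and series with nonzero constant term have genuine inverses.\<close>

definition fps_eval :: "real \<Rightarrow> real poly fps \<Rightarrow> complex fps" where
  "fps_eval x f = Abs_fps (\<lambda>n. of_real (poly (fps_nth f n) x))"

lemma fps_eval_mult: "fps_eval x (f * g) = fps_eval x f * fps_eval x g"
  by (simp add: fps_eval_def fps_eq_iff fps_mult_nth poly_sum)

lemma fps_eval_power: "fps_eval x (f ^ k) = fps_eval x f ^ k"
proof (induction k)
  case 0
  show ?case by (simp add: fps_eval_def fps_eq_iff)
qed (simp add: fps_eval_mult)

lemma fps_eval_denom:
  "fps_eval (cos \<theta>) cheb_denom =
     (1 - fps_const (cis \<theta>) * fps_X) * (1 - fps_const (cis (- \<theta>)) * fps_X)"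
proof -
  have sum2: "cis \<theta> + cis (- \<theta>) = of_real (2 * cos \<theta>)"
    by (simp add: complex_eq_iff)
  have prod1: "cis \<theta> * cis (- \<theta>) = 1"
    by (simp add: cis_mult)
  have "(1 - fps_const (cis \<theta>) * fps_X) * (1 - fps_const (cis (- \<theta>)) * fps_X) =
     1 - fps_const (cis \<theta> + cis (- \<theta>)) * fps_X + fps_const (cis \<theta> * cis (- \<theta>)) * fps_X ^ 2"
    by (simp add: algebra_simps power2_eq_square flip: fps_const_add fps_const_mult)
  also have "\<dots> = fps_eval (cos \<theta>) cheb_denom"
    unfolding sum2 prod1
    by (auto simp: fps_eq_iff fps_eval_def cheb_denom_nth fps_X_nth fps_X_power_nth)
  finally show ?thesis ..
qed

lemma fps_eval_kernel_power:
  "fps_eval (cos \<theta>) (cheb_kernel ^ k) =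
     inverse ((1 - fps_const (cis \<theta>) * fps_X) ^ k) *
     inverse ((1 - fps_const (cis (- \<theta>)) * fps_X) ^ k)"
proof -
  let ?a = "1 - fps_const (cis \<theta>) * fps_X" and ?b = "1 - fps_const (cis (- \<theta>)) * fps_X"
  have "fps_eval (cos \<theta>) cheb_denom * fps_eval (cos \<theta>) cheb_kernel = 1"
    unfolding fps_eval_mult[symmetric] cheb_denom_kernel by (simp add: fps_eval_def fps_eq_iff)
  then have one: "?a ^ k * ?b ^ k * fps_eval (cos \<theta>) (cheb_kernel ^ k) = 1"
    unfolding fps_eval_power fps_eval_denom power_mult_distrib[symmetric] by simp
  have inv: "inverse (?a ^ k) * ?a ^ k = 1" "inverse (?b ^ k) * ?b ^ k = 1"
    by (intro inverse_mult_eq_1; simp add: fps_nth_power_0)+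
  have "fps_eval (cos \<theta>) (cheb_kernel ^ k) = (inverse (?a ^ k) * ?a ^ k) *
      (inverse (?b ^ k) * ?b ^ k) * fps_eval (cos \<theta>) (cheb_kernel ^ k)"
    unfolding inv by simp
  also have "\<dots> = inverse (?a ^ k) * inverse (?b ^ k) *
      (?a ^ k * ?b ^ k * fps_eval (cos \<theta>) (cheb_kernel ^ k))"
    by (simp only: mult_ac)
  finally show ?thesis
    unfolding one by simp
qed

text \<open>The cosine takes every value in [-1, 1], and a nonzero polynomial has only finitely many
  roots.\<close>

lemma poly_eqI_cos:
  fixes p q :: "real poly"
  assumes "\<And>\<theta>. poly p (cos \<theta>) = poly q (cos \<theta>)"
  shows "p = q"
proof (rule ccontr)
  assume "p \<noteq> q"
  then have "finite {x. poly (p - q) x = 0}"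
    by (intro poly_roots_finite) simp
  moreover have "{-1..1} \<subseteq> {x. poly (p - q) x = 0}"
    using assms[of "arccos _"] by auto (metis assms cos_arccos)
  ultimately have "finite {-1..1::real}"
    by (rule finite_subset[rotated])
  then show False
    by (simp add: infinite_Icc)
qed

text \<open>The reflection i -> m - i pairs the indices above \<open>m div 2\<close> with those
  satisfying 2i < m. For even m the middle index is its own mirror image, so doubling the lower half
  counts it once too often.\<close>

lemma sum_symmetric_fold:
  fixes g :: "nat \<Rightarrow> 'a :: comm_ring_1"
  assumes sym: "\<And>i. i \<le> m \<Longrightarrow> g (m - i) = g i"
  shows "(\<Sum>i=0..m. g i) = 2 * (\<Sum>i=0..m div 2. g i) - (if even m then g (m div 2) else 0)"
proof -
  have upper: "(\<Sum>i\<in>{Suc (m div 2)..m}. g i) = (\<Sum>i\<in>{i. 2 * i < m}. g i)"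
    by (rule sum.reindex_bij_witness[of _ "\<lambda>i. m - i" "\<lambda>i. m - i"]) (auto simp: sym)
  have lower: "{0..m div 2} = {i. 2 * i < m} \<union> (if even m then {m div 2} else {})"
  proof (intro set_eqI iffI)
    fix i assume "i \<in> {0..m div 2}"
    then have "2 * i \<le> m" by simp
    then consider "2 * i < m" | "2 * i = m" by linarith
    then show "i \<in> {i. 2 * i < m} \<union> (if even m then {m div 2} else {})"
      by cases auto
  qed (auto split: if_splits)
  have fin: "finite {i. 2 * i < m}"
    by (rule finite_subset[of _ "{..m}"]) auto
  have "(\<Sum>i=0..m div 2. g i) = (\<Sum>i\<in>{i. 2 * i < m}. g i) + (if even m then g (m div 2) else 0)"
    unfolding lower using fin by (subst sum.union_disjoint) (auto split: if_splits)
  moreover have "(\<Sum>i=0..m. g i) = (\<Sum>i=0..m div 2. g i) + (\<Sum>i\<in>{Suc (m div 2)..m}. g i)"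
    by (subst sum.union_disjoint[symmetric]) (auto intro: sum.cong)
  ultimately show ?thesis
    unfolding upper by (simp add: algebra_simps)
qed

text \<open>Cauchy product of the binomial series of (1 - e^(i\<theta>) t)^(-k) and (1 -
  e^(-i\<theta>) t)^(-k).\<close>

lemma poly_kernel_power_nth_cos:
  assumes "k > 0"
  shows "poly (fps_nth (cheb_kernel ^ k) m) (cos \<theta>) =
    (\<Sum>i=0..m. real ((k + i - 1) choose i) * real ((k + (m - i) - 1) choose (m - i))
             * cos ((real m - 2 * real i) * \<theta>))"
proof -
  define b where "b i = real ((k + i - 1) choose i)" for i
  have cos_flip: "cos ((2 * real i - real m) * \<theta>) = cos ((real m - 2 * real i) * \<theta>)" for i
    using cos_minus[of "(real m - 2 * real i) * \<theta>"] by (simp add: algebra_simps)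
  have "complex_of_real (poly (fps_nth (cheb_kernel ^ k) m) (cos \<theta>)) =
      fps_nth (fps_eval (cos \<theta>) (cheb_kernel ^ k)) m"
    by (simp add: fps_eval_def)
  also have "\<dots> = (\<Sum>i=0..m. of_real (b i) * cis \<theta> ^ i * (of_real (b (m - i)) * cis (- \<theta>) ^ (m - i)))"
    unfolding fps_eval_kernel_power one_minus_const_fps_X_neg_power'[OF assms]
    by (simp add: fps_mult_nth b_def)
  also have "\<dots> = (\<Sum>i=0..m. of_real (b i * b (m - i)) * cis ((2 * real i - real m) * \<theta>))"
    by (intro sum.cong refl) (simp add: DeMoivre cis_mult algebra_simps of_nat_diff)
  \<comment> \<open>The coefficient is real, so taking real parts turns the exponentials into
    cosines.\<close>
  finally have "poly (fps_nth (cheb_kernel ^ k) m) (cos \<theta>) =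
      Re (\<Sum>i=0..m. of_real (b i * b (m - i)) * cis ((2 * real i - real m) * \<theta>))"
    by (metis Re_complex_of_real)
  also have "\<dots> = (\<Sum>i=0..m. b i * b (m - i) * cos ((2 * real i - real m) * \<theta>))"
    by simp
  finally show ?thesis
    unfolding b_def cos_flip .
qed

text \<open>The cosine sum is symmetric under i -> m - i, so it folds; on the lower half each cosine
  is a value of some T_(m-2i). The subtracted constant is the middle term, where T_0 = 1 and both
  binomials agree.\<close>

lemma kernel_power_nth_chebyshev:
  assumes "k > 0"
  shows "fps_nth (cheb_kernel ^ k) m =
    smult 2 (\<Sum>i=0..m div 2. smult (real ((k + i - 1) choose (k - 1)) *
        real ((k + (m - i) - 1) choose (k - 1))) (chebyshev_T (m - 2 * i)))
    - [:if even m then real ((k + m div 2 - 1) choose (k - 1)) ^ 2 else 0:]"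
proof (rule poly_eqI_cos)
  fix \<theta>
  define g where "g i = real ((k + i - 1) choose i) * real ((k + (m - i) - 1) choose (m - i))
    * cos ((real m - 2 * real i) * \<theta>)" for i
  have flip: "(k + i - 1) choose i = (k + i - 1) choose (k - 1)" for i
    using binomial_symmetric[of i "k + i - 1"] assms by simp
  have sym: "g (m - i) = g i" if "i \<le> m" for i
  proof -
    have "cos ((real m - 2 * real (m - i)) * \<theta>) = cos ((real m - 2 * real i) * \<theta>)"
      using that cos_minus[of "(real m - 2 * real i) * \<theta>"] by (simp add: of_nat_diff algebra_simps)
    with that show ?thesis
      by (simp add: g_def)
  qed
  have half: "(\<Sum>i=0..m div 2. g i) = poly (\<Sum>i=0..m div 2. smult (real ((k + i - 1) choose (k - 1)) *
        real ((k + (m - i) - 1) choose (k - 1))) (chebyshev_T (m - 2 * i))) (cos \<theta>)"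
    unfolding poly_sum g_def flip
    by (intro sum.cong refl) (simp add: poly_chebyshev_T_cos of_nat_diff)
  have mid: "(if even m then g (m div 2) else 0) =
      (if even m then real ((k + m div 2 - 1) choose (k - 1)) ^ 2 else 0)"
    unfolding g_def flip by (auto simp: power2_eq_square add.commute elim!: evenE)
  show "poly (fps_nth (cheb_kernel ^ k) m) (cos \<theta>) = poly (smult 2 (\<Sum>i=0..m div 2.
      smult (real ((k + i - 1) choose (k - 1)) * real ((k + (m - i) - 1) choose (k - 1)))
        (chebyshev_T (m - 2 * i)))
      - [:if even m then real ((k + m div 2 - 1) choose (k - 1)) ^ 2 else 0:]) (cos \<theta>)"
    using sum_symmetric_fold[of m g, OF sym]
    unfolding poly_kernel_power_nth_cos[OF assms] g_def[symmetric] mid half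
    by simp
qed

subsection \<open>The Chebyshev identities\<close>

lemma smult_sum_right: "smult c (sum f A) = (\<Sum>x\<in>A. smult c (f x))"
  by (induction A rule: infinite_finite_induct) (simp_all add: smult_add_right)

text \<open>The inner sum of (i) is a multiple of the derivative of order \<open>k\<close> of T_n
  plus the constant left by folding. The factor \<open>1 / (2 ^ k * fact k)\<close> combines with
  (-2x)^k to the Taylor weight (-x)^k / k!.\<close>

lemma chebyshev_inner_sum:
  assumes "1 \<le> k" "k \<le> n"
  shows "smult (real n) (\<Sum>i=0..(n - k) div 2.
             smult (1 / real (n - i) * real ((n - i) choose k) * real ((k + i - 1) choose (k - 1)))
               (chebyshev_T (n - k - 2 * i))) =
         smult (1 / (2 ^ k * fact k)) ((pderiv ^^ k) (chebyshev_T n)) +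
         [:if even (n - k) then real n / (2 * real k) * real ((k + (n - k) div 2 - 1) choose (k - 1)) ^ 2 else 0:]"
proof -
  define S where "S = (\<Sum>i=0..(n - k) div 2. smult (real ((k + i - 1) choose (k - 1)) *
        real ((k + (n - k - i) - 1) choose (k - 1))) (chebyshev_T (n - k - 2 * i)))"
  have coeff: "1 / real (n - i) * real ((n - i) choose k) * real ((k + i - 1) choose (k - 1)) =
      1 / real k * (real ((k + i - 1) choose (k - 1)) * real ((k + (n - k - i) - 1) choose (k - 1)))"
    if "i \<le> (n - k) div 2" for i
  proof -
    from that assms have i: "n - i > 0" "k + (n - k - i) - 1 = n - i - 1"
      by auto
    \<comment> \<open>Absorption trades the weight 1/(n-i), which depends on i, for the constant
      1/k.\<close>
    have "k * ((n - i) choose k) = (n - i) * ((n - i - 1) choose (k - 1))"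
      using binomial_absorption[of "k - 1" "n - i"] assms by simp
    then have "real k * real ((n - i) choose k) = real (n - i) * real ((n - i - 1) choose (k - 1))"
      by (metis of_nat_mult)
    with i assms show ?thesis
      by (simp add: field_simps del: of_nat_diff)
  qed
  have inner: "(\<Sum>i=0..(n - k) div 2.
             smult (1 / real (n - i) * real ((n - i) choose k) * real ((k + i - 1) choose (k - 1)))
               (chebyshev_T (n - k - 2 * i))) = smult (1 / real k) S"
    unfolding S_def smult_sum_right smult_smult by (intro sum.cong refl) (simp only: coeff atLeastAtMost_iff)
  obtain j m where jm: "k = Suc j" "n = Suc m" "j \<le> m"
    using assms by (metis Suc_le_D Suc_le_mono One_nat_def le_trans)
  have "1 / (2 ^ k * fact k) * (real n * 2 ^ j * fact j) = real n / (2 * real k)"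
  proof -
    have "2 ^ k = 2 * (2 :: real) ^ j" "fact k = real k * fact j" "real k \<noteq> 0"
      by (simp_all add: jm(1))
    then show ?thesis
      by simp
  qed
  then have "smult (1 / (2 ^ k * fact k)) ((pderiv ^^ k) (chebyshev_T n)) =
      smult (real n / (2 * real k)) (fps_nth (cheb_kernel ^ k) (n - k))"
    using higher_pderiv_chebyshev_T[OF jm(3)] jm(1,2) by simp
  also have "fps_nth (cheb_kernel ^ k) (n - k) = smult 2 S -
      [:if even (n - k) then real ((k + (n - k) div 2 - 1) choose (k - 1)) ^ 2 else 0:]"
    unfolding S_def using assms by (intro kernel_power_nth_chebyshev) simp
  finally show ?thesis
    unfolding inner using assms by (simp add: smult_diff_right)
qed

lemma falling_factorial_altdef: "falling_factorial a m = fact m * (a gchoose m)"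
  by (simp add: falling_factorial_def gbinomial_prod_rev atLeast0LessThan)

text \<open>By \<open>chebyshev_inner_sum\<close> the left side splits into the Taylor expansion of
  T_n with base point x, evaluated at 0, and the folding corrections \<open>M k\<close>. The first
  part is T_n(0); the second matches the sum on the right term by term.\<close>

lemma chebyshev_identity_1:
  assumes "n \<ge> 1"
  shows "chebyshev_T n
       + smult (real n)
          (\<Sum>k=1..n. (smult (-2) (chebyshev_T 1)) ^ k *
             (\<Sum>i=0..(n - k) div 2.
                smult (1 / real (n - i) * real ((n - i) choose k)
                         * real ((k + i - 1) choose (k - 1)))
                  (chebyshev_T (n - k - 2 * i))))
      = smult (real n)
          (\<Sum>k=1..n.
             smult ((-2) ^ k / fact k * ((1 + (-1) ^ (n - k)) / 4)
                      * falling_factorial ((real n + real k) / 2 - 1) (k - 1)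
                      * (((real n + real k) / 2 - 1) gchoose (k - 1)))
               (chebyshev_T 1 ^ k))
        + [:cos (pi * real n / 2):]" (is "?lhs = ?rhs")
proof (rule poly_ext)
  fix x :: real
  define M where "M k = (if even (n - k) then real n / (2 * real k) *
      real ((k + (n - k) div 2 - 1) choose (k - 1)) ^ 2 else 0)" for k
  define p where "p = chebyshev_T n"
  have "poly ?lhs x = poly p x + poly (\<Sum>k=1..n. (smult (-2) (chebyshev_T 1)) ^ k *
      smult (real n) (\<Sum>i=0..(n - k) div 2.
                smult (1 / real (n - i) * real ((n - i) choose k)
                         * real ((k + i - 1) choose (k - 1)))
                  (chebyshev_T (n - k - 2 * i)))) x"
    by (simp only: p_def smult_sum_right[of "real n" _ "{1..n}"] mult_smult_right poly_add)
  also have "\<dots> = poly p x + poly (\<Sum>k=1..n. (smult (-2) (chebyshev_T 1)) ^ k *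
      (smult (1 / (2 ^ k * fact k)) ((pderiv ^^ k) p) + [:M k:])) x"
    by (intro arg_cong2[of _ _ _ _ "(+)"] arg_cong2[of _ _ _ _ poly] sum.cong refl
          arg_cong2[of _ _ _ _ "(*)"])
       (simp only: M_def p_def chebyshev_inner_sum atLeastAtMost_iff)
  also have "\<dots> = (poly p x + (\<Sum>k=1..n. (- x) ^ k / fact k * poly ((pderiv ^^ k) p) x))
      + (\<Sum>k=1..n. (-2 * x) ^ k * M k)"
  proof -
    have "(-2 * x) ^ k * (1 / (2 ^ k * fact k)) = (- x) ^ k / fact k" for k
      using power_mult_distrib[of 2 "- x" k] by (simp add: field_simps)
    then have "(-2 * x) ^ k * (1 / (2 ^ k * fact k) * y + M k) =
        (- x) ^ k / fact k * y + (-2 * x) ^ k * M k" for k y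
      by (simp only: distrib_left mult.assoc[symmetric])
    moreover have "poly (smult (-2) (chebyshev_T 1)) x = -2 * x" "poly [:c:] x = c" for c
      by (simp_all add: chebyshev_T_1[simplified])
    ultimately show ?thesis
      by (simp only: poly_sum poly_power poly_mult poly_add poly_smult sum.distrib add.assoc)
  qed
  also have "poly p x + (\<Sum>k=1..n. (- x) ^ k / fact k * poly ((pderiv ^^ k) p) x) =
      (\<Sum>k\<le>n. (0 - x) ^ k / fact k * poly ((pderiv ^^ k) p) x)"
    by (simp add: sum.atMost_shift sum.atLeast1_atMost_eq lessThan_Suc_atMost)
  also have "\<dots> = cos (pi * real n / 2)"
    unfolding p_def poly_taylor[OF degree_chebyshev_T_le] by (rule poly_chebyshev_T_at_0)
  also have "cos (pi * real n / 2) + (\<Sum>k=1..n. (-2 * x) ^ k * M k) = poly ?rhs x"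
  proof -
    have "(-2 * x) ^ k * M k = real n * ((-2) ^ k / fact k * ((1 + (-1) ^ (n - k)) / 4)
                      * falling_factorial ((real n + real k) / 2 - 1) (k - 1)
                      * (((real n + real k) / 2 - 1) gchoose (k - 1)) * x ^ k)"
      if k: "1 \<le> k" "k \<le> n" for k
    \<comment> \<open>For even n - k the number (n+k)/2 - 1 is a natural number \<open>a\<close>,
      and the generalized binomial is an ordinary one. For odd n - k both sides are 0.\<close>
    proof (cases "even (n - k)")
      case True
      define a where "a = k + (n - k) div 2 - 1"
      have a: "(real n + real k) / 2 - 1 = real a"
      proof -
        obtain c where "n - k = 2 * c"
          using True by (elim evenE)
        moreover from this have "n = k + 2 * c"
          using k by simp
        ultimately show ?thesis
          using k by (simp add: a_def of_nat_diff)
      qed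
      have ff: "falling_factorial (real a) (k - 1) = fact (k - 1) * real (a choose (k - 1))"
        by (simp only: falling_factorial_altdef binomial_gbinomial)
      have "fact k = real k * fact (k - 1)"
        using k by (simp add: fact_reduce)
      then show ?thesis
        unfolding a ff binomial_gbinomial[symmetric] power_mult_distrib using True k
        by (simp add: M_def a_def field_simps power2_eq_square)
    qed (simp add: M_def)
    then show ?thesis
      by (simp add: poly_sum poly_power chebyshev_T_1[simplified] sum_distrib_left)
  qed
  finally show "poly ?lhs x = poly ?rhs x" .
qed

text \<open>Sum over the exponent r = n - k - 2i of T_1 instead of the index k of T_k. The rows r >=
  1 form the sum in (i), while the row r = 0 collapses to T_n / n.\<close>

lemma chebyshev_sum_reindex:
  assumes "n \<ge> 1"
  shows "(\<Sum>k=0..n.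
        (\<Sum>i=0..(n - k) div 2.
           smult ((-2) ^ (n - (k + 2 * i)) * (1 / real (n - i))
                    * real ((n - i) choose (k + i))
                    * ((real n - real k - real i - 1) gchoose i))
             (chebyshev_T 1 ^ (n - (k + 2 * i))))
        * chebyshev_T k) =
     smult (1 / real n) (chebyshev_T n) +
     (\<Sum>k=1..n. (smult (-2) (chebyshev_T 1)) ^ k *
             (\<Sum>i=0..(n - k) div 2.
                smult (1 / real (n - i) * real ((n - i) choose k)
                         * real ((k + i - 1) choose (k - 1)))
                  (chebyshev_T (n - k - 2 * i))))" (is "?lhs = _ + ?rhs")
proof -
  define f where "f k i = smult ((-2) ^ (n - (k + 2 * i)) * (1 / real (n - i))
                    * real ((n - i) choose (k + i))
                    * ((real n - real k - real i - 1) gchoose i))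
             (chebyshev_T 1 ^ (n - (k + 2 * i))) * chebyshev_T k" for k i
  \<comment> \<open>In the row r = 0 the last binomial is i - 1 over i. It vanishes for i > 0, but
    for i = 0 it is -1 over 0, which equals 1.\<close>
  have f_zero: "f (n - 2 * i) i = (if i = 0 then smult (1 / real n) (chebyshev_T n) else 0)"
    if "i \<le> n div 2" for i
  proof (cases "i = 0")
    case False
    have "(real i - 1 gchoose i) = real ((i - 1) choose i)"
      unfolding binomial_gbinomial using False by (simp add: of_nat_diff)
    also have "\<dots> = 0"
      using False by (simp add: binomial_eq_0)
    finally show ?thesis
      using False that by (simp add: f_def of_nat_diff algebra_simps)
  qed (simp add: f_def)
  have f_pos: "f (n - r - 2 * i) i = (smult (-2) (chebyshev_T 1)) ^ r *
      smult (1 / real (n - i) * real ((n - i) choose r) * real ((r + i - 1) choose (r - 1)))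
                  (chebyshev_T (n - r - 2 * i))"
    if r: "1 \<le> r" "r \<le> n" and i: "i \<le> (n - r) div 2" for r i
  proof -
    from r i have le: "r + 2 * i \<le> n" by auto
    define k where "k = n - r - 2 * i"
    have k: "n - (k + 2 * i) = r" "n - i - (k + i) = r" "k + i \<le> n - i"
      using le by (auto simp: k_def)
    have c1: "(n - i) choose (k + i) = (n - i) choose r"
      using binomial_symmetric[OF k(3)] k(2) by simp
    have c2: "real n - real k - real i - 1 = real (r + i - 1)"
      using le r by (auto simp: k_def of_nat_diff)
    have c3: "(r + i - 1) choose i = (r + i - 1) choose (r - 1)"
      using binomial_symmetric[of i "r + i - 1"] r by simp
    show ?thesis
      unfolding f_def k_def[symmetric] k(1) c1 c2 binomial_gbinomial[symmetric] c3
      by (simp only: smult_power mult_smult_left mult_smult_right smult_smult mult_ac)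
  qed
  have "?lhs = (\<Sum>k=0..n. \<Sum>i=0..(n - k) div 2. f k i)"
    by (simp add: f_def sum_distrib_right)
  also have "\<dots> = (\<Sum>(k, i)\<in>(SIGMA k:{0..n}. {0..(n - k) div 2}). f k i)"
    by (simp add: sum.Sigma)
  also have "\<dots> = (\<Sum>(r, i)\<in>(SIGMA r:{0..n}. {0..(n - r) div 2}). f (n - r - 2 * i) i)"
    \<comment> \<open>The substitution is an involution of the index set, so one map serves in both
      directions.\<close>
    by (rule sum.reindex_bij_witness[of _ "\<lambda>(r, i). (n - r - 2 * i, i)" "\<lambda>(r, i). (n - r - 2 * i, i)"])
       auto
  also have "\<dots> = (\<Sum>r=0..n. \<Sum>i=0..(n - r) div 2. f (n - r - 2 * i) i)"
    by (simp add: sum.Sigma)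
  also have "\<dots> = (\<Sum>i=0..n div 2. f (n - 2 * i) i) + (\<Sum>r=1..n. \<Sum>i=0..(n - r) div 2. f (n - r - 2 * i) i)"
    by (simp add: sum.atLeast_Suc_atMost)
  also have "(\<Sum>i=0..n div 2. f (n - 2 * i) i) =
      (\<Sum>i=0..n div 2. if i = 0 then smult (1 / real n) (chebyshev_T n) else 0)"
    by (intro sum.cong refl) (simp only: f_zero atLeastAtMost_iff)
  also have "\<dots> = smult (1 / real n) (chebyshev_T n)"
    by simp
  also have "(\<Sum>r=1..n. \<Sum>i=0..(n - r) div 2. f (n - r - 2 * i) i) = ?rhs"
    unfolding sum_distrib_left
    by (intro sum.cong refl) (simp only: f_pos atLeastAtMost_iff)
  finally show ?thesis .
qed

lemma chebyshev_identity_2: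
  assumes "n \<ge> 1"
  shows "(\<Sum>k=0..n.
        (\<Sum>i=0..(n - k) div 2.
           smult ((-2) ^ (n - (k + 2 * i)) * (1 / real (n - i))
                    * real ((n - i) choose (k + i))
                    * ((real n - real k - real i - 1) gchoose i))
             (chebyshev_T 1 ^ (n - (k + 2 * i))))
        * chebyshev_T k)
      = (\<Sum>k=0..n.
          smult ((1 + (-1) ^ (n - k)) * (real k * (-2) ^ k / (real n + real k) ^ 2)
                   * (((real n + real k) / 2) gchoose k) ^ 2)
            (chebyshev_T 1 ^ k))
        + [:1 / real n * cos (pi * real n / 2):]"
proof -
  define S where "S = (\<Sum>k=1..n. (smult (-2) (chebyshev_T 1)) ^ k *
             (\<Sum>i=0..(n - k) div 2.
                smult (1 / real (n - i) * real ((n - i) choose k)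
                         * real ((k + i - 1) choose (k - 1)))
                  (chebyshev_T (n - k - 2 * i))))"
  have coeff: "(-2) ^ k / fact k * ((1 + (-1) ^ (n - k)) / 4)
                      * falling_factorial ((real n + real k) / 2 - 1) (k - 1)
                      * (((real n + real k) / 2 - 1) gchoose (k - 1)) =
      (1 + (-1) ^ (n - k)) * (real k * (-2) ^ k / (real n + real k) ^ 2)
                   * (((real n + real k) / 2) gchoose k) ^ 2" if k: "1 \<le> k" for k
  proof -
    define a where "a = (real n + real k) / 2"
    have a: "real n + real k = 2 * a" "a \<noteq> 0"
      using k by (auto simp: a_def)
    have ff: "falling_factorial (a - 1) (k - 1) = fact (k - 1) * (a - 1 gchoose (k - 1))"
      by (rule falling_factorial_altdef)
    \<comment> \<open>With the falling factorial written as (k-1)! times a binomial, absorption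
      turns the product of the two into the square of \<open>a gchoose k\<close>.\<close>
    have g: "(a gchoose k) = a / real k * (a - 1 gchoose (k - 1))"
      using gbinomial_absorption'[of k a] k by simp
    have f: "fact k = real k * fact (k - 1)"
      using k by (simp add: fact_reduce)
    have "(-2) ^ k / fact k * ((1 + (-1) ^ (n - k)) / 4)
                      * falling_factorial (a - 1) (k - 1) * (a - 1 gchoose (k - 1)) =
      (1 + (-1) ^ (n - k)) * (real k * (-2) ^ k / (2 * a) ^ 2) * (a gchoose k) ^ 2"
      unfolding ff g f using a k by (simp add: field_simps power2_eq_square)
    then show ?thesis
      by (simp only: a(1)) simp
  qed
  have "smult (1 / real n) (chebyshev_T n) + S = smult (1 / real n) (chebyshev_T n + smult (real n) S)"
    using assms by (simp add: smult_add_right)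
  also have "\<dots> = smult (1 / real n) (smult (real n)
          (\<Sum>k=1..n.
             smult ((-2) ^ k / fact k * ((1 + (-1) ^ (n - k)) / 4)
                      * falling_factorial ((real n + real k) / 2 - 1) (k - 1)
                      * (((real n + real k) / 2 - 1) gchoose (k - 1)))
               (chebyshev_T 1 ^ k))
        + [:cos (pi * real n / 2):])"
    unfolding S_def chebyshev_identity_1[OF assms] ..
  also have "\<dots> = (\<Sum>k=1..n.
             smult ((-2) ^ k / fact k * ((1 + (-1) ^ (n - k)) / 4)
                      * falling_factorial ((real n + real k) / 2 - 1) (k - 1)
                      * (((real n + real k) / 2 - 1) gchoose (k - 1)))
               (chebyshev_T 1 ^ k)) + [:1 / real n * cos (pi * real n / 2):]"
    using assms by (simp add: smult_add_right)
  also have "(\<Sum>k=1..n.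
             smult ((-2) ^ k / fact k * ((1 + (-1) ^ (n - k)) / 4)
                      * falling_factorial ((real n + real k) / 2 - 1) (k - 1)
                      * (((real n + real k) / 2 - 1) gchoose (k - 1)))
               (chebyshev_T 1 ^ k)) = (\<Sum>k=1..n.
          smult ((1 + (-1) ^ (n - k)) * (real k * (-2) ^ k / (real n + real k) ^ 2)
                   * (((real n + real k) / 2) gchoose k) ^ 2)
            (chebyshev_T 1 ^ k))"
    by (intro sum.cong refl) (simp only: coeff atLeastAtMost_iff)
  \<comment> \<open>The added summand k = 0 vanishes because of its factor
    \<open>real k\<close>.\<close>
  also have "\<dots> = (\<Sum>k=0..n.
          smult ((1 + (-1) ^ (n - k)) * (real k * (-2) ^ k / (real n + real k) ^ 2)
                   * (((real n + real k) / 2) gchoose k) ^ 2)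
            (chebyshev_T 1 ^ k))"
    by (simp add: sum.atLeast_Suc_atMost[of 0])
  finally show ?thesis
    unfolding chebyshev_sum_reindex[OF assms] S_def .
qed

subsection \<open>Jacobi polynomials\<close>

text \<open>Differentiate the expansion in powers of (x - 1)/2 term by term and shift the index;
  \<open>coeff\<close> is the absorption that extracts the common factor
  \<open>A / 2\<close>.\<close>

lemma pderiv_jacobi_P:
  "pderiv (jacobi_P (Suc n) a b) = smult ((real n + a + b + 2) / 2) (jacobi_P n (a + 1) (b + 1))"
proof -
  define y where "y = [:-1/2, 1/2::real:]"
  define A where "A = real n + a + b + 2"
  have dy: "pderiv (y ^ Suc j) = smult (real (Suc j) / 2) (y ^ j)" for j
    by (simp only: pderiv_power_Suc) (simp add: y_def pderiv_pCons)
  have coeff: "((A + real j) gchoose Suc j) * (real (Suc j) / 2) = A / 2 * ((A + real j) gchoose j)" for j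
    using gbinomial_mult_1[of "A + real j" j] by (simp add: algebra_simps)
  have "pderiv (jacobi_P (Suc n) a b) = (\<Sum>m=0..Suc n. smult (((real (Suc n) + a) gchoose (Suc n - m)) *
                       ((real (Suc n) + a + b + real m) gchoose m)) (pderiv (y ^ m)))"
    by (simp only: jacobi_P_def pderiv_sum pderiv_smult y_def)
  also have "\<dots> = (\<Sum>j=0..n. smult (((real (Suc n) + a) gchoose (n - j)) *
                       ((real (Suc n) + a + b + real (Suc j)) gchoose Suc j)) (pderiv (y ^ Suc j)))"
    by (subst sum.atLeast0_atMost_Suc_shift) simp
  also have "\<dots> = (\<Sum>j=0..n. smult (A / 2) (smult (((real n + (a + 1)) gchoose (n - j)) *
                       ((real n + (a + 1) + (b + 1) + real j) gchoose j)) (y ^ j)))"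
  proof (intro sum.cong refl)
    fix j
    have "real (Suc n) + a + b + real (Suc j) = A + real j" "real n + (a + 1) + (b + 1) + real j = A + real j"
      "real (Suc n) + a = real n + (a + 1)"
      by (simp_all add: A_def)
    then show "smult (((real (Suc n) + a) gchoose (n - j)) *
          ((real (Suc n) + a + b + real (Suc j)) gchoose Suc j)) (pderiv (y ^ Suc j)) =
        smult (A / 2) (smult (((real n + (a + 1)) gchoose (n - j)) *
          ((real n + (a + 1) + (b + 1) + real j) gchoose j)) (y ^ j))"
      by (simp only: dy smult_smult mult.assoc coeff) (simp only: mult_ac)
  qed
  finally show ?thesis
    by (simp only: jacobi_P_def y_def A_def smult_sum_right)
qed

text \<open>Passing from order k to k + 1 lowers the degree by one and raises both parameters by
  one, which gives the factor (n + k)/2; these factors multiply to the rising factorial over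
  2^k.\<close>

lemma higher_pderiv_jacobi_P:
  "k \<le> n \<Longrightarrow> (pderiv ^^ k) (jacobi_P n (-1/2) (-1/2)) =
     smult (pochhammer (real n) k / 2 ^ k) (jacobi_P (n - k) (real k - 1/2) (real k - 1/2))"
proof (induction k)
  case (Suc k)
  define m where "m = n - Suc k"
  have m: "n - k = Suc m" "real m = real n - real k - 1"
    using Suc.prems by (auto simp: m_def of_nat_diff)
  have "(real m + (real k - 1/2) + (real k - 1/2) + 2) / 2 = (real n + real k) / 2"
    by (simp add: m(2))
  moreover have "real k - 1/2 + 1 = real (Suc k) - 1/2"
    by simp
  ultimately have step: "pderiv (jacobi_P (n - k) (real k - 1/2) (real k - 1/2)) =
      smult ((real n + real k) / 2) (jacobi_P m (real (Suc k) - 1/2) (real (Suc k) - 1/2))"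
    unfolding m(1) pderiv_jacobi_P by (simp only:)
  show ?case
    using Suc by (simp add: pderiv_smult step pochhammer_Suc mult.commute[of 2] flip: m_def)
qed simp

lemma degree_jacobi_P_le: "degree (jacobi_P n a b) \<le> n"
  unfolding jacobi_P_def
  by (intro degree_sum_le) (auto intro!: order_trans[OF degree_smult_le] order_trans[OF degree_power_le])

text \<open>At x = 1, that is \<theta> = 0, both linear factors are 1 - t, so F^m becomes (1 -
  t)^(-2m).\<close>

lemma poly_higher_pderiv_chebyshev_T_at_1:
  assumes "1 \<le> m" "m \<le> n"
  shows "poly ((pderiv ^^ m) (chebyshev_T n)) 1 =
     real n * 2 ^ (m - 1) * fact (m - 1) * real ((n + m - 1) choose (n - m))"
proof -
  obtain j l where jl: "m = Suc j" "n = Suc l" "j \<le> l"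
    using assms by (metis Suc_le_D Suc_le_mono One_nat_def le_trans)
  have "fps_eval 1 (cheb_kernel ^ m) = inverse ((1 - fps_const 1 * fps_X) ^ (2 * m))"
    using fps_eval_kernel_power[of 0 m]
    by (simp add: mult_2 power_add fps_inverse_mult)
  then have "complex_of_real (poly (fps_nth (cheb_kernel ^ m) (n - m)) 1) =
      of_nat ((2 * m + (n - m) - 1) choose (n - m))"
    using one_minus_const_fps_X_neg_power'[of "2 * m" "1 :: complex"] assms
    by (simp add: fps_eval_def fps_eq_iff)
  also have "2 * m + (n - m) - 1 = n + m - 1"
    using assms by simp
  finally have "poly (fps_nth (cheb_kernel ^ m) (n - m)) 1 = real ((n + m - 1) choose (n - m))"
    by (metis of_real_eq_iff of_real_of_nat_eq)
  then show ?thesis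
    using higher_pderiv_chebyshev_T[OF jl(3)] jl(1,2) by simp
qed

text \<open>The expansion of the Jacobi polynomial in powers of (x - 1)/2 and the Taylor expansion
  of T_n at 1, both evaluated at 0, agree term by term up to the factor (1/2)_n / n!.\<close>

lemma poly_jacobi_P_at_0:
  assumes "n \<ge> 1"
  shows "poly (jacobi_P n (-1/2) (-1/2)) 0 = pochhammer (1/2) n * (1 / fact n) * cos (pi * real n / 2)"
proof -
  have summand: "((real n - 1/2) gchoose (n - m)) * ((real n - 1 + real m) gchoose m) * (-1/2) ^ m =
      pochhammer (1/2) n / fact n * ((-1) ^ m / fact m * poly ((pderiv ^^ m) (chebyshev_T n)) 1)"
    if "m \<le> n" for m
  \<comment> \<open>The closed form for the derivatives of T_n at 1 requires m >= 1.\<close>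
  proof (cases "m = 0")
    case True
    have "(real n - 1/2) gchoose n = pochhammer (1/2) n / fact n"
      by (simp add: gbinomial_pochhammer')
    moreover have "poly (chebyshev_T n) 1 = 1"
      using poly_chebyshev_T_cos[of n 0] by simp
    ultimately show ?thesis
      using True by simp
  next
    case False
    define B where "B = pochhammer (1/2 + real m) (n - m)"
    define A where "A = pochhammer (1/2 :: real) m"
    \<comment> \<open>\<open>B\<close> is the numerator of the first binomial; \<open>A\<close>
      cancels against (2m)! = 4^m (1/2)_m m!.\<close>
    have AB: "pochhammer (1/2) n = A * B"
      unfolding A_def B_def by (rule pochhammer_product[OF that])
    have g1: "(real n - 1/2) gchoose (n - m) = B / fact (n - m)"
    proof -
      have "real n - 1/2 - real (n - m) + 1 = 1/2 + real m"
        using that by (simp add: of_nat_diff)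
      then show ?thesis
        by (simp only: gbinomial_pochhammer' B_def)
    qed
    have "(real n - 1 + real m) gchoose m = real ((n + m - 1) choose m)"
      unfolding binomial_gbinomial using False that by (simp add: of_nat_diff algebra_simps)
    also have "\<dots> = fact (n + m - 1) / (fact m * fact (n - 1))"
      using assms by (subst binomial_fact) auto
    finally have g2: "(real n - 1 + real m) gchoose m = fact (n + m - 1) / (fact m * fact (n - 1))" .
    have "n + m - 1 - (n - m) = 2 * m - 1"
      using that by auto
    then have c: "real ((n + m - 1) choose (n - m)) = fact (n + m - 1) / (fact (n - m) * fact (2 * m - 1))"
      using False by (subst binomial_fact) auto
    have fn: "fact n = real n * fact (n - 1)" and fm: "fact m = real m * fact (m - 1)"
      using False assms by (simp_all add: fact_reduce)
    have "2 * real m * fact (2 * m - 1) = fact (2 * m)"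
      using False by (simp add: fact_reduce[of "2 * m"])
    also have "\<dots> = 4 ^ m * A * fact m"
      using fact_double[of m, where 'a = real] by (simp add: A_def power_mult)
    finally have f2m: "fact (2 * m - 1) = 4 ^ m * A * fact m / (2 * real m)"
      using False by (simp add: field_simps)
    have A: "A > 0"
      unfolding A_def by (rule pochhammer_pos) simp
    have pw: "2 * 2 ^ (m - 1) = (2 :: real) ^ m" "(4 :: real) ^ m = 2 ^ m * 2 ^ m"
      using False by (simp_all flip: power_Suc power_mult_distrib)
    have "pochhammer (1/2) n / fact n * (1 / fact m * poly ((pderiv ^^ m) (chebyshev_T n)) 1) =
        A * B / (real n * fact (n - 1)) * (1 / (real m * fact (m - 1)) * (real n * 2 ^ (m - 1) * fact (m - 1) *
          (fact (n + m - 1) / (fact (n - m) * (4 ^ m * A * fact m / (2 * real m))))))"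
      using False that
      by (simp only: AB fn fm[symmetric] poly_higher_pderiv_chebyshev_T_at_1 c f2m)
    also have "\<dots> = B * (2 * 2 ^ (m - 1)) / fact (n - 1) * fact (n + m - 1) / (fact (n - m) * (4 ^ m * fact m))"
      using A False assms by (simp add: field_simps)
    also have "\<dots> = B / fact (n - m) * (fact (n + m - 1) / (fact m * fact (n - 1))) * (1 / 2 ^ m)"
      unfolding pw by (simp add: field_simps)
    finally have eq: "pochhammer (1/2) n / fact n * (1 / fact m * poly ((pderiv ^^ m) (chebyshev_T n)) 1) =
      ((real n - 1/2) gchoose (n - m)) * ((real n - 1 + real m) gchoose m) * (1 / 2 ^ m)"
      unfolding g1 g2 .
    have "(-1/2 :: real) ^ m = (-1) ^ m * (1 / 2 ^ m)"
      by (simp only: power_divide) simp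
    then have "((real n - 1/2) gchoose (n - m)) * ((real n - 1 + real m) gchoose m) * (-1/2) ^ m =
        (-1) ^ m * (((real n - 1/2) gchoose (n - m)) * ((real n - 1 + real m) gchoose m) * (1 / 2 ^ m))"
      by (simp only: mult_ac)
    then show ?thesis
      unfolding eq[symmetric] by simp
  qed
  have "poly (jacobi_P n (-1/2) (-1/2)) 0 =
      (\<Sum>m\<le>n. ((real n - 1/2) gchoose (n - m)) * ((real n - 1 + real m) gchoose m) * (-1/2) ^ m)"
    unfolding jacobi_P_def poly_sum atLeast0AtMost by (intro sum.cong refl) (simp add: poly_power algebra_simps)
  also have "\<dots> = (\<Sum>m\<le>n. pochhammer (1/2) n / fact n *
      ((0 - 1) ^ m / fact m * poly ((pderiv ^^ m) (chebyshev_T n)) 1))"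
    by (intro sum.cong refl) (simp only: summand diff_0 atMost_iff)
  also have "\<dots> = pochhammer (1/2) n / fact n * poly (chebyshev_T n) 0"
    unfolding sum_distrib_left[symmetric] poly_taylor[OF degree_chebyshev_T_le] ..
  finally show ?thesis
    by (simp add: poly_chebyshev_T_at_0)
qed

text \<open>Since (n+k-1)!/(n-1)! is the rising factorial (n)_k, the summands are the Taylor terms
  of \<open>p\<close> with base point x, evaluated at 0.\<close>

lemma jacobi_identity:
  assumes "n \<ge> 1"
  shows "jacobi_P n (-1/2) (-1/2)
       + (\<Sum>k=1..n.
            smult (fact (n + k - 1) / (fact k * 2 ^ k * fact (n - 1)))
              ((- [:0, 1:]) ^ k * jacobi_P (n - k) (real k - 1/2) (real k - 1/2)))
      = [:pochhammer (1/2) n * (1 / fact n) * cos (pi * real n / 2):]" (is "?lhs = ?rhs")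
proof (rule poly_ext)
  fix x :: real
  define p where "p = jacobi_P n (-1/2) (-1/2)"
  have poch: "fact (n + k - 1) = pochhammer (real n) k * fact (n - 1)" for k
  proof (induction k)
    case (Suc k)
    have "fact (n + Suc k - 1) = real (n + k) * fact (n + k - 1)"
      using assms by (simp add: fact_reduce)
    with Suc show ?case
      by (simp add: pochhammer_Suc)
  qed simp
  have "fact (n + k - 1) / (fact k * 2 ^ k * fact (n - 1)) *
      ((- x) ^ k * poly (jacobi_P (n - k) (real k - 1/2) (real k - 1/2)) x) =
      (0 - x) ^ k / fact k * poly ((pderiv ^^ k) p) x" if "k \<le> n" for k
    unfolding p_def higher_pderiv_jacobi_P[OF that] poch by simp
  then have "poly ?lhs x = poly p x + (\<Sum>k=1..n. (0 - x) ^ k / fact k * poly ((pderiv ^^ k) p) x)"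
    by (simp add: poly_sum poly_power p_def)
  also have "\<dots> = (\<Sum>k\<le>n. (0 - x) ^ k / fact k * poly ((pderiv ^^ k) p) x)"
    by (simp add: sum.atMost_shift sum.atLeast1_atMost_eq lessThan_Suc_atMost)
  also have "\<dots> = poly p 0"
    unfolding p_def by (rule poly_taylor[OF degree_jacobi_P_le])
  also have "\<dots> = poly ?rhs x"
    unfolding p_def poly_jacobi_P_at_0[OF assms] by simp
  finally show "poly ?lhs x = poly ?rhs x" .
qed

theorem theorem1:
  fixes n :: nat
  assumes "n \<ge> 1"
  shows
    "(chebyshev_T n
       + smult (real n)
          (\<Sum>k=1..n. (smult (-2) (chebyshev_T 1)) ^ k *
             (\<Sum>i=0..(n - k) div 2.
                smult (1 / real (n - i) * real ((n - i) choose k)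
                         * real ((k + i - 1) choose (k - 1)))
                  (chebyshev_T (n - k - 2 * i))))
      = smult (real n)
          (\<Sum>k=1..n.
             smult ((-2) ^ k / fact k * ((1 + (-1) ^ (n - k)) / 4)
                      * falling_factorial ((real n + real k) / 2 - 1) (k - 1)
                      * (((real n + real k) / 2 - 1) gchoose (k - 1)))
               (chebyshev_T 1 ^ k))
        + [:cos (pi * real n / 2):])
   \<and>
     ((\<Sum>k=0..n.
        (\<Sum>i=0..(n - k) div 2.
           smult ((-2) ^ (n - (k + 2 * i)) * (1 / real (n - i))
                    * real ((n - i) choose (k + i))
                    * ((real n - real k - real i - 1) gchoose i))
             (chebyshev_T 1 ^ (n - (k + 2 * i))))
        * chebyshev_T k)
      = (\<Sum>k=0..n.
          smult ((1 + (-1) ^ (n - k)) * (real k * (-2) ^ k / (real n + real k) ^ 2)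
                   * (((real n + real k) / 2) gchoose k) ^ 2)
            (chebyshev_T 1 ^ k))
        + [:1 / real n * cos (pi * real n / 2):])
   \<and>
     (jacobi_P n (-1/2) (-1/2)
       + (\<Sum>k=1..n.
            smult (fact (n + k - 1) / (fact k * 2 ^ k * fact (n - 1)))
              ((- [:0, 1:]) ^ k * jacobi_P (n - k) (real k - 1/2) (real k - 1/2)))
      = [:pochhammer (1/2) n * (1 / fact n) * cos (pi * real n / 2):])"
  by (intro conjI chebyshev_identity_1[OF assms] chebyshev_identity_2[OF assms]
      jacobi_identity[OF assms])

end
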